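(* Let $C$ be a round circle in a plane $\Pi\subset\mathbb{R}^3$ and let $S\subset\mathbb{R}^3$ be a compact surface with constant mean curvature whose boundary is $C$. If $S$ is a graph over $\Pi$, then $S$ is either the planar disk bounded by $C$ or a small spherical cap bounded by $C$.
   Context: Surfaces are smooth. A CMC surface is a surface in Euclidean space $\mathbb{R}^3$ whose mean curvature $H$ (half the sum of the principal curvatures with respect to a unit normal $N$) is the same constant at every point; $H=0$ is allowed. That $S$, with boundary $C$, is a graph over $\Pi$ means the following: after a rigid motion taking $\Pi$ to the plane $\{z=0\}$, $S$ is the graph $z=f(x,y)$ of a smooth function $f$ on the closed round disk bounded by $C$ in $\Pi$, with $f=0$ on $C$. The unit normal is taken to be $N=(-f_x,-f_y,1)/\sqrt{1+f_x^2+f_y^2}$, and the mean curvature satisfies $\operatorname{div}\big(\nabla f/\sqrt{1+|\nabla f|^2}\big)=2H$. Spherical caps: let $r>0$ be the radius of $C$. If $C$ lies in a round sphere $S(R)$ of radius $R\ge r$, then $C$ splits $S(R)$ into two compact pieces with boundary $C$, called spherical caps. If $R=r$ both are hemispheres; if $R>r$ the two caps are geometrically distinct, and they are called the small and the big spherical cap. The small one is the one contained in a hemisphere of $S(R)$. *)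

theory Defs
  imports "HOL-Analysis.Analysis"
begin

text \<open>
  Smoothness (class C-infinity) on an open set, by iterated directional derivatives.  The
  definition is only meaningful for open sets, since it uses the full Frechet derivative.
\<close>

primrec Ck_on :: "nat \<Rightarrow> 'a::euclidean_space set \<Rightarrow> ('a \<Rightarrow> 'b::euclidean_space) \<Rightarrow> bool" where
  "Ck_on 0 U f \<longleftrightarrow> continuous_on U f"
| "Ck_on (Suc k) U f \<longleftrightarrow>
     (\<forall>x\<in>U. f differentiable (at x)) \<and> (\<forall>v. Ck_on k U (\<lambda>x. frechet_derivative f (at x) v))"

definition smooth_on :: "'a::euclidean_space set \<Rightarrow> ('a \<Rightarrow> 'b::euclidean_space) \<Rightarrow> bool" where
  "smooth_on U f \<longleftrightarrow> (\<forall>k. Ck_on k U f)"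

text \<open>
  Smoothness on a set \<open>X\<close> that need not be open: smooth extendability to an open neighbourhood.
  Functions being total, the values of \<open>f\<close> outside \<open>X\<close> already are such an extension.
\<close>

definition smooth_near :: "'a::euclidean_space set \<Rightarrow> ('a \<Rightarrow> 'b::euclidean_space) \<Rightarrow> bool" where
  "smooth_near X f \<longleftrightarrow> (\<exists>U. open U \<and> X \<subseteq> U \<and> smooth_on U f)"

definition smooth_diffeo ::
  "(real^3) set \<Rightarrow> (real^3) set \<Rightarrow> (real^3 \<Rightarrow> real^3) \<Rightarrow> (real^3 \<Rightarrow> real^3) \<Rightarrow> bool" where
  "smooth_diffeo V W \<Phi> \<Psi> \<longleftrightarrow>
     open V \<and> open W \<and> homeomorphism V W \<Phi> \<Psi> \<and> smooth_on V \<Phi> \<and> smooth_on W \<Psi>"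

text \<open>
  \<open>S\<close> is a smooth compact (embedded) surface with boundary \<open>C\<close>: ambient charts flatten \<open>S\<close> to a
  plane around the points outside \<open>C\<close>, and to a closed half-plane around the points of \<open>C\<close>, which
  are sent to the edge of the half-plane.
\<close>

definition compact_surface_with_boundary :: "(real^3) set \<Rightarrow> (real^3) set \<Rightarrow> bool" where
  "compact_surface_with_boundary S C \<longleftrightarrow>
     compact S \<and> C \<subseteq> S \<and>
     (\<forall>p\<in>S - C. \<exists>V W \<Phi> \<Psi>. p \<in> V \<and> smooth_diffeo V W \<Phi> \<Psi> \<and>
        \<Phi> ` (S \<inter> V) = {y \<in> W. y$3 = 0}) \<and>
     (\<forall>p\<in>C. \<exists>V W \<Phi> \<Psi>. p \<in> V \<and> smooth_diffeo V W \<Phi> \<Psi> \<and> \<Phi> p $ 1 = 0 \<and>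
        \<Phi> ` (S \<inter> V) = {y \<in> W. y$3 = 0 \<and> 0 \<le> y$1})"

text \<open>
  One-sided velocities of curves in \<open>S\<close> starting at \<open>p\<close> fill the tangent plane at an interior
  point and a half-plane of it at a boundary point; the span is the tangent plane in both cases.
\<close>

definition tangent_space :: "(real^3) set \<Rightarrow> real^3 \<Rightarrow> (real^3) set" where
  "tangent_space S p =
     span {v. \<exists>\<gamma>. \<gamma> 0 = p \<and> \<gamma> ` {0..1} \<subseteq> S \<and>
                  (\<gamma> has_vector_derivative v) (at (0::real) within {0..1})}"

definition unit_normal_field :: "(real^3) set \<Rightarrow> (real^3 \<Rightarrow> real^3) \<Rightarrow> bool" where
  "unit_normal_field S N \<longleftrightarrow>
     smooth_near S N \<and> (\<forall>p\<in>S. norm (N p) = 1 \<and> (\<forall>v\<in>tangent_space S p. N p \<bullet> v = 0))"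

text \<open>
  The principal curvatures are the eigenvalues, with multiplicity, of the shape operator \<open>- dN\<close> on
  the tangent plane.  On tangent vectors the derivative of \<open>N\<close> depends only on \<open>N\<close> restricted to \<open>S\<close>.
\<close>

definition principal_curvatures ::
  "(real^3) set \<Rightarrow> (real^3 \<Rightarrow> real^3) \<Rightarrow> real^3 \<Rightarrow> real \<Rightarrow> real \<Rightarrow> bool" where
  "principal_curvatures S N p k1 k2 \<longleftrightarrow>
     (\<exists>e1\<in>tangent_space S p. \<exists>e2\<in>tangent_space S p.
        norm e1 = 1 \<and> norm e2 = 1 \<and> e1 \<bullet> e2 = 0 \<and>
        - frechet_derivative N (at p) e1 = k1 *\<^sub>R e1 \<and>
        - frechet_derivative N (at p) e2 = k2 *\<^sub>R e2)"

definition has_mean_curvature ::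
  "(real^3) set \<Rightarrow> (real^3 \<Rightarrow> real^3) \<Rightarrow> real^3 \<Rightarrow> real \<Rightarrow> bool" where
  "has_mean_curvature S N p H \<longleftrightarrow>
     (\<exists>k1 k2. principal_curvatures S N p k1 k2 \<and> H = (k1 + k2) / 2)"

definition constant_mean_curvature :: "(real^3) set \<Rightarrow> bool" where
  "constant_mean_curvature S \<longleftrightarrow>
     (\<exists>N H. unit_normal_field S N \<and> (\<forall>p\<in>S. has_mean_curvature S N p H))"

definition rigid_motion :: "(real^3 \<Rightarrow> real^3) \<Rightarrow> bool" where
  "rigid_motion T \<longleftrightarrow> (\<exists>Q b. orthogonal_transformation Q \<and> T = (\<lambda>x. Q x + b))"

definition space_point :: "real^2 \<Rightarrow> real \<Rightarrow> real^3" where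
  "space_point u z = vector [u$1, u$2, z]"

text \<open>
  For a plane \<open>P\<close>, the circle in \<open>P\<close> with centre \<open>c\<close> and radius \<open>r\<close> is \<open>P \<inter> sphere c r\<close>, and the
  closed disk that it bounds in \<open>P\<close> is \<open>P \<inter> cball c r\<close>.
\<close>

definition graph_over_disk :: "(real^3) set \<Rightarrow> real^3 \<Rightarrow> real \<Rightarrow> (real^3) set \<Rightarrow> bool" where
  "graph_over_disk P c r S \<longleftrightarrow>
     (\<exists>T D f. rigid_motion T \<and> T ` P = {x. x$3 = 0} \<and>
        D = {u. space_point u 0 \<in> T ` (P \<inter> cball c r)} \<and>
        smooth_near D f \<and>
        T ` S = {space_point u (f u) | u. u \<in> D} \<and>
        (\<forall>u. space_point u 0 \<in> T ` (P \<inter> sphere c r) \<longrightarrow> f u = 0))"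

definition spherical_cap :: "(real^3) set \<Rightarrow> real^3 \<Rightarrow> real \<Rightarrow> (real^3) set \<Rightarrow> bool" where
  "spherical_cap C a R K \<longleftrightarrow>
     C \<subseteq> sphere a R \<and> (\<exists>U \<in> components (sphere a R - C). K = U \<union> C)"

definition hemisphere :: "real^3 \<Rightarrow> real \<Rightarrow> real^3 \<Rightarrow> (real^3) set" where
  "hemisphere a R n = {x \<in> sphere a R. 0 \<le> n \<bullet> (x - a)}"

text \<open>
  Here \<open>r\<close> is the radius of the circle \<open>C\<close>.  The case \<open>R = r\<close>, where both caps are hemispheres, is
  excluded: only for \<open>r < R\<close> is there a small cap and a big cap.
\<close>

definition small_spherical_cap :: "(real^3) set \<Rightarrow> real \<Rightarrow> (real^3) set \<Rightarrow> bool" where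
  "small_spherical_cap C r K \<longleftrightarrow>
     (\<exists>a R. r < R \<and> spherical_cap C a R K \<and> (\<exists>n. n \<noteq> 0 \<and> K \<subseteq> hemisphere a R n))"

end

theory Submission
  imports Defs
begin

text \<open>
  In coordinates adapted to the plane, \<open>S\<close> is the graph of a function \<open>F\<close> on the disk of radius
  \<open>r\<close> that vanishes on the boundary circle.  For every \<open>s\<close> with \<open>\<bar>s\<bar> * r < 1\<close> there is exactly
  one small cap of mean curvature \<open>s\<close> with respect to the upward normal over the same disk, the
  graph of \<open>cap_height r s\<close>; for \<open>s = 0\<close> it is the flat disk.  The proof compares \<open>F\<close> with these
  caps.

  The comparison is a touching argument.  If \<open>F - cap_height r s\<close> has a maximum in the
  interior of the disk, then there the graph touches a vertical translate of the cap from below.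
  The cap is umbilic, all its normal curvatures being \<open>s\<close>, so no principal curvature of the graph
  can exceed \<open>s\<close> at that point (lemma \<open>principal_curvature_le_at_max\<close>).  Hence, if the mean
  curvature \<open>H\<close> of the graph is larger than \<open>s\<close>, the difference is largest on the boundary,
  where it is zero: \<open>F \<le> cap_height r s\<close> (lemma \<open>below_cap_of_smaller_curvature\<close>).  The comparison
  is made for strictly smaller \<open>s\<close>, where the second-order condition at a maximum is already
  contradictory; for \<open>s = H\<close> it would not be.

  The limit \<open>s \<longlonglongrightarrow> H\<close> gives \<open>F \<le> cap_height r H\<close>, and reflection in the plane gives the opposite
  inequality, so \<open>F = cap_height r H\<close> (lemma \<open>eq_cap_if_normal_up\<close>).  This requires
  \<open>\<bar>H\<bar> * r < 1\<close>.  Otherwise, up to reflection, \<open>F\<close> would lie below every cap with \<open>s < 1 / r\<close>, hence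
  below the hemisphere of radius \<open>r\<close>; that hemisphere is vertical along the circle, whereas \<open>F\<close> has a
  finite slope there (lemma \<open>mean_curvature_bound\<close>).
\<close>

section \<open>Height functions of spherical caps\<close>

text \<open>
  For \<open>s > 0\<close> and \<open>R = 1 / s\<close> this is \<open>sqrt (R\<^sup>2 - r\<^sup>2) - sqrt (R\<^sup>2 - (norm w)\<^sup>2)\<close>, the lower cap of a
  sphere of radius \<open>R\<close>, with the numerator rationalised: in this form the value depends
  continuously on \<open>s\<close> through \<open>s = 0\<close> and up to the hemispheres \<open>s = 1 / r\<close> and \<open>s = - 1 / r\<close>.
\<close>

definition cap_height :: "real \<Rightarrow> real \<Rightarrow> 'a::real_inner \<Rightarrow> real" where
  "cap_height r s w =
     - s * (r\<^sup>2 - (norm w)\<^sup>2) / (sqrt (1 - s\<^sup>2 * (norm w)\<^sup>2) + sqrt (1 - s\<^sup>2 * r\<^sup>2))"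

lemma cap_radicand_pos:
  fixes w :: "'a::real_inner"
  assumes "\<bar>s\<bar> * r < 1" "norm w \<le> r"
  shows "s\<^sup>2 * (norm w)\<^sup>2 < 1"
proof -
  have "\<bar>s\<bar> * norm w \<le> \<bar>s\<bar> * r"
    using assms(2) by (simp add: mult_left_mono)
  then have "\<bar>s\<bar> * norm w < 1"
    using assms(1) by linarith
  then have "(\<bar>s\<bar> * norm w)\<^sup>2 < 1"
    by (simp add: power_less_one_iff abs_square_less_1)
  then show ?thesis
    by (simp add: power_mult_distrib)
qed

text \<open>
  This form is the one to differentiate.  It includes \<open>s = 0\<close> because \<open>0 / 0 = 0\<close>.
\<close>

lemma cap_height_eq:
  fixes w :: "'a::real_inner"
  assumes "\<bar>s\<bar> * r < 1" "norm w \<le> r"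
  shows "cap_height r s w = (sqrt (1 - s\<^sup>2 * r\<^sup>2) - sqrt (1 - s\<^sup>2 * (norm w)\<^sup>2)) / s"
proof (cases "s = 0")
  case True
  then show ?thesis by (simp add: cap_height_def)
next
  case False
  have r: "0 \<le> r" using assms(2) norm_ge_zero order_trans by blast
  define q where "q = sqrt (1 - s\<^sup>2 * (norm w)\<^sup>2)"
  define B where "B = sqrt (1 - s\<^sup>2 * r\<^sup>2)"
  have q: "q > 0" "q\<^sup>2 = 1 - s\<^sup>2 * (norm w)\<^sup>2"
    using cap_radicand_pos[OF assms] by (simp_all add: q_def)
  have B: "B > 0" "B\<^sup>2 = 1 - s\<^sup>2 * r\<^sup>2"
    using cap_radicand_pos[of s r r] assms(1) r by (simp_all add: B_def)
  have "(B - q) * (B + q) = - s * (r\<^sup>2 - (norm w)\<^sup>2) * s"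
    using q(2) B(2) by (simp add: algebra_simps power2_eq_square)
  then show ?thesis
    using q(1) B(1) False
    unfolding cap_height_def q_def[symmetric] B_def[symmetric] by (simp add: field_simps)
qed

lemma cap_height_boundary: "norm w = r \<Longrightarrow> cap_height r s w = 0"
  by (simp add: cap_height_def)

lemma cap_height_minus: "cap_height r (- s) w = - cap_height r s w"
  by (simp add: cap_height_def)

lemma tendsto_cap_height:
  fixes w :: "'a::real_inner"
  assumes "\<bar>s\<bar> * r \<le> 1" "norm w < r"
  shows "((\<lambda>s. cap_height r s w) \<longlongrightarrow> cap_height r s w) (at s within A)"
proof -
  have r: "r > 0" using assms(2) norm_ge_zero le_less_trans by blast
  have "s\<^sup>2 * (norm w)\<^sup>2 < 1"
  proof (cases "s = 0")
    case False
    then have "\<bar>s\<bar> * norm w < \<bar>s\<bar> * r" using assms(2) by simp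
    then have "(\<bar>s\<bar> * norm w)\<^sup>2 < 1"
      using assms(1) by (simp add: abs_square_less_1)
    then show ?thesis by (simp add: power_mult_distrib)
  qed simp
  moreover have "(\<bar>s\<bar> * r)\<^sup>2 \<le> 1"
    using assms(1) r by (simp add: abs_square_le_1)
  then have "s\<^sup>2 * r\<^sup>2 \<le> 1" by (simp add: power_mult_distrib)
  ultimately have "sqrt (1 - s\<^sup>2 * (norm w)\<^sup>2) + sqrt (1 - s\<^sup>2 * r\<^sup>2) > 0"
    by (simp add: add_pos_nonneg)
  then show ?thesis
    unfolding cap_height_def by (intro tendsto_intros) auto
qed

text \<open>
  The square root is the vertical component of the unit normal of the cap.
\<close>

lemma cap_normal_height_deriv:
  fixes w v :: "'a::real_inner"
  assumes "s\<^sup>2 * (norm (w + t *\<^sub>R v))\<^sup>2 < 1"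
  shows "((\<lambda>t. sqrt (1 - s\<^sup>2 * (norm (w + t *\<^sub>R v))\<^sup>2)) has_real_derivative
           - s\<^sup>2 * ((w + t *\<^sub>R v) \<bullet> v) / sqrt (1 - s\<^sup>2 * (norm (w + t *\<^sub>R v))\<^sup>2)) (at t)"
proof -
  have eq: "(norm (w + t *\<^sub>R v))\<^sup>2 = w \<bullet> w + 2 * t * (w \<bullet> v) + t\<^sup>2 * (v \<bullet> v)" for t
    by (simp only: power2_norm_eq_inner)
       (simp add: inner_add_left inner_add_right inner_commute power2_eq_square algebra_simps)
  have in_eq: "(w + t *\<^sub>R v) \<bullet> v = w \<bullet> v + t * (v \<bullet> v)"
    by (simp add: inner_add_left)
  show ?thesis
    using assms unfolding eq in_eq
    by (auto intro!: derivative_eq_intros simp: field_simps)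
qed

lemma cap_height_line_deriv:
  fixes w v :: "'a::real_inner"
  assumes sr: "\<bar>s\<bar> * r < 1" and w: "norm (w + t *\<^sub>R v) < r"
  shows "((\<lambda>t. cap_height r s (w + t *\<^sub>R v)) has_real_derivative
           s * ((w + t *\<^sub>R v) \<bullet> v) / sqrt (1 - s\<^sup>2 * (norm (w + t *\<^sub>R v))\<^sup>2)) (at t)"
proof (cases "s = 0")
  case True
  then show ?thesis by (simp add: cap_height_def)
next
  case False
  let ?q = "\<lambda>t. sqrt (1 - s\<^sup>2 * (norm (w + t *\<^sub>R v))\<^sup>2)"
  have op: "open {t. norm (w + t *\<^sub>R v) < r}"
    by (intro open_Collect_less continuous_intros)
  have "s\<^sup>2 * (norm (w + t *\<^sub>R v))\<^sup>2 < 1"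
    using cap_radicand_pos[OF sr, of "w + t *\<^sub>R v"] w by simp
  note q = cap_normal_height_deriv[OF this]
  have "((\<lambda>t. (sqrt (1 - s\<^sup>2 * r\<^sup>2) - ?q t) / s) has_real_derivative
          (0 - - s\<^sup>2 * ((w + t *\<^sub>R v) \<bullet> v) / ?q t) / s) (at t)"
    by (rule DERIV_cdivide[OF DERIV_diff[OF DERIV_const q]])
  also have "(0 - - s\<^sup>2 * ((w + t *\<^sub>R v) \<bullet> v) / ?q t) / s = s * ((w + t *\<^sub>R v) \<bullet> v) / ?q t"
    using False by (simp add: power2_eq_square)
  finally show ?thesis
    by (rule has_field_derivative_transform_within_open[OF _ op])
       (use w in \<open>auto simp: cap_height_eq[OF sr] less_imp_le\<close>)
qed

lemma continuous_on_cap_height: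
  fixes r s :: real
  assumes sr: "\<bar>s\<bar> * r < 1"
  shows "continuous_on (cball (0::'a::real_inner) r) (cap_height r s)"
proof -
  have "continuous_on (cball (0::'a) r)
          (\<lambda>w. (sqrt (1 - s\<^sup>2 * r\<^sup>2) - sqrt (1 - s\<^sup>2 * (norm w)\<^sup>2)) * inverse s)"
    by (intro continuous_intros)
  then show ?thesis
    by (rule continuous_on_eq) (simp add: cap_height_eq[OF sr] divide_inverse)
qed

lemma line_stays_in_disk:
  fixes w v :: "'a::real_normed_vector"
  assumes "norm w < r"
  obtains d where "d > 0" "\<And>t. \<bar>t\<bar> < d \<Longrightarrow> norm (w + t *\<^sub>R v) < r"
proof -
  have "open {t. norm (w + t *\<^sub>R v) < r}"
    by (intro open_Collect_less continuous_intros)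
  then obtain d where "d > 0" "ball 0 d \<subseteq> {t. norm (w + t *\<^sub>R v) < r}"
    using openE[of "{t. norm (w + t *\<^sub>R v) < r}" 0] assms by auto
  then show thesis using that[of d] by (auto simp: subset_iff)
qed

lemma vector_derivative_quotient:
  assumes "(f has_vector_derivative f') (at (0::real))" "f 0 = 0"
  shows "((\<lambda>t. (1 / t) *\<^sub>R f t) \<longlongrightarrow> f') (at 0)"
proof -
  have "((\<lambda>t. norm (f t - t *\<^sub>R f') / norm t) \<longlongrightarrow> 0) (at 0)"
    using assms by (simp add: has_vector_derivative_def has_derivative_at)
  then have "((\<lambda>t. norm ((1 / t) *\<^sub>R f t - f')) \<longlongrightarrow> 0) (at 0)"
  proof (rule Lim_transform_eventually,
      intro eventually_at_filter[THEN iffD2] always_eventually allI impI)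
    fix t :: real assume "t \<noteq> 0"
    then have "(1 / t) *\<^sub>R f t - f' = (1 / t) *\<^sub>R (f t - t *\<^sub>R f')"
      by (simp add: scaleR_diff_right)
    then show "norm (f t - t *\<^sub>R f') / norm t = norm ((1 / t) *\<^sub>R f t - f')" by simp
  qed
  then show ?thesis using LIM_zero_cancel tendsto_norm_zero_iff by blast
qed

section \<open>Unit normals\<close>

text \<open>
  The regularity is stated for the first derivative alone, so that passing from \<open>N\<close> to \<open>- N\<close>, which
  turns a graph with downward normal into one with upward normal, preserves it at once.
\<close>

definition unit_normal :: "(real^3) set \<Rightarrow> (real^3 \<Rightarrow> real^3) \<Rightarrow> bool" where
  "unit_normal S N \<longleftrightarrow> (\<forall>p\<in>S. N differentiable (at p) \<and> norm (N p) = 1 \<and>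
     (\<forall>v\<in>tangent_space S p. N p \<bullet> v = 0))"

lemma smooth_near_differentiable:
  assumes "smooth_near X f" "x \<in> X"
  shows "f differentiable (at x)"
proof -
  obtain U where "X \<subseteq> U" "smooth_on U f"
    using assms unfolding smooth_near_def by blast
  then have "Ck_on (Suc 0) U f" unfolding smooth_on_def by blast
  then show ?thesis using \<open>X \<subseteq> U\<close> assms(2) by auto
qed

lemma unit_normal_field_imp_unit_normal:
  assumes "unit_normal_field S N"
  shows "unit_normal S N"
  using assms smooth_near_differentiable unfolding unit_normal_def unit_normal_field_def by blast

lemma unit_normal_minus: "unit_normal S N \<Longrightarrow> unit_normal S (\<lambda>p. - N p)"
  unfolding unit_normal_def by auto

lemma has_mean_curvature_minus:
  assumes N: "N differentiable (at p)" and H: "has_mean_curvature S N p H"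
  shows "has_mean_curvature S (\<lambda>p. - N p) p (- H)"
proof -
  have D: "frechet_derivative (\<lambda>p. - N p) (at p) = (\<lambda>v. - frechet_derivative N (at p) v)"
    by (rule frechet_derivative_at[symmetric])
       (intro has_derivative_minus N[unfolded frechet_derivative_works])
  obtain k1 k2 where k: "principal_curvatures S N p k1 k2" and Hk: "H = (k1 + k2) / 2"
    using H unfolding has_mean_curvature_def by blast
  have flip: "- x = k *\<^sub>R e \<Longrightarrow> - (- x) = (- k) *\<^sub>R e" for x e :: "real^3" and k
    by simp
  from k have "principal_curvatures S (\<lambda>p. - N p) p (- k1) (- k2)"
    unfolding principal_curvatures_def D by (meson flip)
  then show ?thesis
    unfolding has_mean_curvature_def using Hk
    by (intro exI[of _ "- k1"] exI[of _ "- k2"]) simp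
qed

section \<open>Graphs over a disk in an orthonormal frame\<close>

text \<open>
  \<open>J\<close> is an isometry of the coordinate plane onto the direction of the plane of the circle, \<open>E\<close> a
  unit normal of that plane.  The hypotheses are invariant under \<open>E \<mapsto> - E\<close>, \<open>F \<mapsto> - F\<close>,
  which exchanges upper and lower bounds for \<open>F\<close>.
\<close>

locale disk_graph =
  fixes c :: "real^3" and J :: "real^2 \<Rightarrow> real^3" and E :: "real^3"
    and r :: real and F :: "real^2 \<Rightarrow> real"
  assumes linear_J: "linear J"
    and J_inner: "J w \<bullet> J v = w \<bullet> v"
    and E_J: "E \<bullet> J w = 0"
    and E_E: "E \<bullet> E = 1"
    and frame: "\<exists>w z. x = J w + z *\<^sub>R E"
    and r_pos: "r > 0"
    and F_diff: "norm w \<le> r \<Longrightarrow> F differentiable (at w)"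
    and F_boundary: "norm w = r \<Longrightarrow> F w = 0"
begin

definition surf :: "real^2 \<Rightarrow> real^3" where
  "surf w = c + J w + F w *\<^sub>R E"

definition surface :: "(real^3) set" where
  "surface = surf ` cball 0 r"

definition tangent_vector :: "real^2 \<Rightarrow> real^2 \<Rightarrow> real^3" where
  "tangent_vector w v = J v + frechet_derivative F (at w) v *\<^sub>R E"

lemma J_E: "J w \<bullet> E = 0"
  using E_J by (simp add: inner_commute)

lemma J_lin: "J (a + b) = J a + J b" "J (k *\<^sub>R a) = k *\<^sub>R J a"
    "J (a - b) = J a - J b" "J 0 = 0" "J (- a) = - J a"
  using linear_J by (simp_all add: linear_add linear_cmul linear_diff linear_0 linear_neg)

lemmas frame_simps = inner_add_left inner_add_right inner_diff_left inner_diff_right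
  J_inner E_J J_E E_E

lemma norm_frame: "(norm (J w + z *\<^sub>R E))\<^sup>2 = (norm w)\<^sup>2 + z\<^sup>2"
  by (simp only: power2_norm_eq_inner) (simp add: frame_simps power2_eq_square)

lemma F_has_derivative:
  assumes "norm w \<le> r"
  shows "(F has_derivative frechet_derivative F (at w)) (at w within A)"
  using F_diff[OF assms] frechet_derivative_works has_derivative_at_withinI by blast

lemma continuous_F: "continuous_on (cball 0 r) F"
  by (intro differentiable_imp_continuous_on differentiable_at_imp_differentiable_on)
     (auto intro: F_diff)

lemma linear_DF: "norm w \<le> r \<Longrightarrow> linear (frechet_derivative F (at w))"
  using F_diff linear_frechet_derivative by blast

lemma continuous_surf: "continuous_on (cball 0 r) surf"
  unfolding surf_def using linear_continuous_on[of J] linear_J continuous_F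
  by (intro continuous_intros) (auto simp: linear_conv_bounded_linear)

lemma surf_line_deriv:
  assumes w: "norm (w + t *\<^sub>R v) \<le> r"
  shows "((\<lambda>t. F (w + t *\<^sub>R v)) has_real_derivative
            frechet_derivative F (at (w + t *\<^sub>R v)) v) (at t within A)"
    and "((\<lambda>t. surf (w + t *\<^sub>R v)) has_vector_derivative
            tangent_vector (w + t *\<^sub>R v) v) (at t within A)"
proof -
  let ?D = "frechet_derivative F (at (w + t *\<^sub>R v))"
  have l: "((\<lambda>t. w + t *\<^sub>R v) has_derivative (\<lambda>h. h *\<^sub>R v)) (at t within A)"
    by (auto intro!: derivative_eq_intros)
  have "((\<lambda>t. F (w + t *\<^sub>R v)) has_derivative (\<lambda>h. ?D (h *\<^sub>R v))) (at t within A)"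
    by (rule has_derivative_compose[OF l F_has_derivative[OF w]])
  also have "(\<lambda>h. ?D (h *\<^sub>R v)) = (*) (?D v)"
    using linear_cmul[OF linear_DF[OF w]] by (auto simp: fun_eq_iff mult.commute)
  finally show F: "((\<lambda>t. F (w + t *\<^sub>R v)) has_real_derivative ?D v) (at t within A)"
    by (simp add: has_field_derivative_def)
  have "((\<lambda>t. c + (J w + t *\<^sub>R J v) + F (w + t *\<^sub>R v) *\<^sub>R E) has_vector_derivative
           0 + (0 + (t *\<^sub>R 0 + 1 *\<^sub>R J v)) + (F (w + t *\<^sub>R v) *\<^sub>R 0 + ?D v *\<^sub>R E)) (at t within A)"
    by (intro derivative_intros has_vector_derivative_scaleR F)
  then show "((\<lambda>t. surf (w + t *\<^sub>R v)) has_vector_derivative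
            tangent_vector (w + t *\<^sub>R v) v) (at t within A)"
    by (simp add: surf_def tangent_vector_def J_lin)
qed

text \<open>
  A curve \<open>\<gamma>\<close> in the surface is the lift of its projection \<open>\<omega>\<close> to the disk, so the chain rule gives its
  velocity.  This holds on the boundary circle as well, \<open>F\<close> being differentiable there.
\<close>

lemma tangent_space_surfE:
  assumes w: "norm w \<le> r" and e: "e \<in> tangent_space surface (surf w)"
  obtains v where "e = tangent_vector w v"
proof -
  let ?D = "frechet_derivative F (at w)"
  have sub: "subspace (range (tangent_vector w))"
    using linear_DF[OF w] linear_J
    by (intro linear_subspace_image subspace_UNIV)
       (auto simp: tangent_vector_def linear_iff J_lin algebra_simps)
  have "{v. \<exists>\<gamma>. \<gamma> 0 = surf w \<and> \<gamma> ` {0..1} \<subseteq> surface \<and>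
          (\<gamma> has_vector_derivative v) (at (0::real) within {0..1})} \<subseteq> range (tangent_vector w)"
  proof (clarify)
    fix x \<gamma>
    assume g0: "\<gamma> 0 = surf w" and gS: "\<gamma> ` {0..1} \<subseteq> surface"
      and gd: "(\<gamma> has_vector_derivative x) (at (0::real) within {0..1})"
    define \<omega> where "\<omega> t = adjoint J (\<gamma> t - c)" for t
    have adj: "adjoint J (J y + z *\<^sub>R E) = y" for y z
      by (rule vector_eq_rdot[THEN iffD1])
         (simp add: adjoint_works[OF linear_J] adjoint_clauses[OF linear_J] frame_simps)
    have om: "\<omega> t = y" if "\<gamma> t = surf y" for t y
      using that adj[of y "F y"] by (simp add: \<omega>_def surf_def add_ac)
    have gom: "\<gamma> t = surf (\<omega> t)" if "t \<in> {0..1}" for t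
      using gS that om unfolding surface_def by blast
    have bl: "bounded_linear (adjoint J)"
      using adjoint_linear[OF linear_J] by (simp add: linear_conv_bounded_linear)
    have "((\<lambda>t. \<gamma> t - c) has_vector_derivative x - 0) (at 0 within {0..1})"
      by (intro derivative_intros gd)
    then have omd: "(\<omega> has_vector_derivative adjoint J x) (at 0 within {0..1})"
      unfolding \<omega>_def using bounded_linear.has_vector_derivative[OF bl] by fastforce
    have om0: "\<omega> 0 = w" using om g0 by blast
    have Jd: "((\<lambda>t. J (\<omega> t)) has_vector_derivative J (adjoint J x)) (at 0 within {0..1})"
      using bounded_linear.has_vector_derivative[OF _ omd] linear_J
      by (simp add: linear_conv_bounded_linear)
    have "((\<lambda>t. F (\<omega> t)) has_derivative (\<lambda>h. ?D (h *\<^sub>R adjoint J x))) (at 0 within {0..1})"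
      by (rule has_derivative_compose[OF omd[unfolded has_vector_derivative_def]])
         (simp add: om0 F_has_derivative[OF w])
    then have Fd: "((\<lambda>t. F (\<omega> t)) has_real_derivative ?D (adjoint J x)) (at 0 within {0..1})"
      using linear_cmul[OF linear_DF[OF w]]
      by (simp add: has_field_derivative_def) (simp add: mult_commute_abs)
    have "((\<lambda>t. c + J (\<omega> t) + F (\<omega> t) *\<^sub>R E) has_vector_derivative
            0 + J (adjoint J x) + (F (\<omega> 0) *\<^sub>R 0 + ?D (adjoint J x) *\<^sub>R E)) (at 0 within {0..1})"
      by (intro derivative_intros has_vector_derivative_scaleR Fd Jd)
    then have "((\<lambda>t. surf (\<omega> t)) has_vector_derivative tangent_vector w (adjoint J x))
                 (at 0 within {0..1})"
      by (simp add: surf_def tangent_vector_def)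
    then have "(\<gamma> has_vector_derivative tangent_vector w (adjoint J x)) (at 0 within {0..1})"
      by (rule has_vector_derivative_transform[rotated 2]) (use gom in auto)
    with gd have "x = tangent_vector w (adjoint J x)"
      by (intro vector_derivative_unique_within[of 0 "{0..1}" \<gamma>])
         (auto simp: trivial_limit_within islimpt_Icc)
    then show "x \<in> range (tangent_vector w)" by blast
  qed
  then have "tangent_space surface (surf w) \<subseteq> range (tangent_vector w)"
    unfolding tangent_space_def by (intro span_minimal sub)
  then show thesis using e that by blast
qed

text \<open>
  Interior points only: the line through \<open>w\<close> in direction \<open>v\<close> must stay in the disk for a while.
\<close>

lemma tangent_vector_in_tangent_space:
  assumes w: "norm w < r"
  shows "tangent_vector w v \<in> tangent_space surface (surf w)"
proof -
  define d where "d = (r - norm w) / (norm v + 1)"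
  have d: "d > 0" using w by (simp add: d_def add_nonneg_pos)
  have "d * (norm v + 1) = r - norm w"
    using norm_ge_zero[of v] by (simp add: d_def add_nonneg_eq_0_iff)
  then have dv: "d * norm v \<le> r - norm w"
    using d by (simp add: distrib_left)
  have inside: "norm (w + t *\<^sub>R (d *\<^sub>R v)) \<le> r" if "t \<in> {0..1}" for t
  proof -
    have "norm (w + t *\<^sub>R (d *\<^sub>R v)) \<le> norm w + t * (d * norm v)"
      using norm_triangle_ineq[of w "t *\<^sub>R (d *\<^sub>R v)"] that d by simp
    also have "t * (d * norm v) \<le> 1 * (d * norm v)"
      using that d by (intro mult_right_mono) auto
    finally show ?thesis using dv by simp
  qed
  have "((\<lambda>t. surf (w + t *\<^sub>R (d *\<^sub>R v))) has_vector_derivative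
            tangent_vector w (d *\<^sub>R v)) (at 0 within {0..1})"
    using surf_line_deriv(2)[of w 0 "d *\<^sub>R v"] w by simp
  moreover have "(\<lambda>t. surf (w + t *\<^sub>R (d *\<^sub>R v))) ` {0..1} \<subseteq> surface"
    unfolding surface_def using inside by auto
  ultimately have "tangent_vector w (d *\<^sub>R v) \<in> tangent_space surface (surf w)"
    unfolding tangent_space_def
    by (intro span_base CollectI exI[of _ "\<lambda>t. surf (w + t *\<^sub>R (d *\<^sub>R v))"]) auto
  then have "(1/d) *\<^sub>R tangent_vector w (d *\<^sub>R v) \<in> tangent_space surface (surf w)"
    unfolding tangent_space_def by (rule span_scale)
  also have "(1/d) *\<^sub>R tangent_vector w (d *\<^sub>R v) = tangent_vector w v"
    using d linear_cmul[OF linear_DF] w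
    by (simp add: tangent_vector_def J_lin scaleR_add_right)
  finally show ?thesis .
qed

lemma normal_orthogonal:
  assumes "unit_normal surface N" "norm w < r"
  shows "N (surf w) \<bullet> tangent_vector w v = 0"
  using assms tangent_vector_in_tangent_space[OF assms(2)]
  unfolding unit_normal_def surface_def by auto

lemma normal_not_horizontal:
  assumes N: "unit_normal surface N" and w: "norm w < r"
  shows "N (surf w) \<bullet> E \<noteq> 0"
proof
  assume 0: "N (surf w) \<bullet> E = 0"
  have "N (surf w) \<bullet> J v = 0" for v
    using normal_orthogonal[OF N w, of v] 0
    by (simp add: tangent_vector_def inner_add_right)
  moreover obtain y z where "N (surf w) = J y + z *\<^sub>R E" using frame by blast
  ultimately have "N (surf w) \<bullet> N (surf w) = 0"
    using 0 by (metis inner_add_right inner_scaleR_right add_0 mult_zero_right)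
  then have "N (surf w) = 0" by simp
  moreover have "norm (N (surf w)) = 1"
    using N w unfolding unit_normal_def surface_def by auto
  ultimately show False by simp
qed

text \<open>
  The normal is nowhere horizontal, and the disk is connected.
\<close>

lemma normal_constant_sign:
  assumes N: "unit_normal surface N"
  shows "(\<forall>w\<in>ball 0 r. N (surf w) \<bullet> E > 0) \<or> (\<forall>w\<in>ball 0 r. N (surf w) \<bullet> E < 0)"
proof -
  have "continuous_on surface N"
    using N unfolding unit_normal_def
    by (intro differentiable_imp_continuous_on differentiable_at_imp_differentiable_on) auto
  then have "continuous_on (cball 0 r) (\<lambda>w. N (surf w))"
    by (intro continuous_on_compose2[OF _ continuous_surf]) (auto simp: surface_def)
  then have "continuous_on (ball 0 r) (\<lambda>w. N (surf w) \<bullet> E)"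
    by (intro continuous_intros continuous_on_subset[OF _ ball_subset_cball])
  then have "connected ((\<lambda>w. N (surf w) \<bullet> E) ` ball 0 r)"
    by (intro connected_continuous_image) auto
  then have "is_interval ((\<lambda>w. N (surf w) \<bullet> E) ` ball 0 r)"
    by (simp add: is_interval_connected_1)
  moreover have "0 \<notin> (\<lambda>w. N (surf w) \<bullet> E) ` ball 0 r"
    using normal_not_horizontal[OF N] by auto
  ultimately have same: "\<not> (N (surf a) \<bullet> E < 0 \<and> 0 < N (surf b) \<bullet> E)"
    if "a \<in> ball 0 r" "b \<in> ball 0 r" for a b
    using that unfolding is_interval_1 by (meson imageI less_imp_le)
  show ?thesis
  proof (rule ccontr)
    assume "\<not> ?thesis"
    then obtain a b where "a \<in> ball 0 r" "b \<in> ball 0 r"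
      "\<not> N (surf a) \<bullet> E < 0" "\<not> N (surf b) \<bullet> E > 0" by blast
    moreover from this have "N (surf a) \<bullet> E \<noteq> 0" "N (surf b) \<bullet> E \<noteq> 0"
      using normal_not_horizontal[OF N] by auto
    ultimately show False using same[of b a] by linarith
  qed
qed

section \<open>Comparison with spherical caps\<close>

text \<open>
  The derivative of \<open>cap_height r s\<close> at \<open>w\<close> in direction \<open>v\<close>, for \<open>\<bar>s\<bar> * r < 1\<close> and \<open>norm w < r\<close>.
\<close>

definition cap_slope :: "real \<Rightarrow> real^2 \<Rightarrow> real^2 \<Rightarrow> real" where
  "cap_slope s w v = s * (w \<bullet> v) / sqrt (1 - s\<^sup>2 * (norm w)\<^sup>2)"

lemma gradients_agree_at_max:
  assumes sr: "\<bar>s\<bar> * r < 1" and w0: "norm w0 < r"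
    and max: "\<And>w. norm w < r \<Longrightarrow> F w - cap_height r s w \<le> F w0 - cap_height r s w0"
  shows "frechet_derivative F (at w0) v = cap_slope s w0 v"
proof -
  obtain d where d: "d > 0" "\<And>t. \<bar>t\<bar> < d \<Longrightarrow> norm (w0 + t *\<^sub>R v) < r"
    using line_stays_in_disk[OF w0] by blast
  have "((\<lambda>t. F (w0 + t *\<^sub>R v) - cap_height r s (w0 + t *\<^sub>R v)) has_real_derivative
          frechet_derivative F (at w0) v - cap_slope s w0 v) (at 0)"
    using DERIV_diff[OF surf_line_deriv(1)[of w0 0 v UNIV] cap_height_line_deriv[OF sr, of w0 0 v]] w0
    by (simp add: cap_slope_def)
  then have "frechet_derivative F (at w0) v - cap_slope s w0 v = 0"
    by (rule DERIV_local_max[OF _ d(1)]) (use max d(2) in simp)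
  then show ?thesis by simp
qed

text \<open>
  Equal gradients give parallel normals.  Both are unit vectors pointing upwards, so they agree.
\<close>

lemma normal_eq_cap_normal:
  assumes N: "unit_normal surface N" and up: "N (surf w) \<bullet> E > 0"
    and sr: "\<bar>s\<bar> * r < 1" and w: "norm w < r"
    and grad: "\<And>v. frechet_derivative F (at w) v = cap_slope s w v"
  shows "N (surf w) = - s *\<^sub>R J w + sqrt (1 - s\<^sup>2 * (norm w)\<^sup>2) *\<^sub>R E"
proof -
  define q where "q = sqrt (1 - s\<^sup>2 * (norm w)\<^sup>2)"
  have q: "q > 0" "q\<^sup>2 = 1 - s\<^sup>2 * (norm w)\<^sup>2"
    using cap_radicand_pos[OF sr, of w] w by (simp_all add: q_def)
  obtain x z where xz: "N (surf w) = J x + z *\<^sub>R E" using frame by blast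
  have z: "z > 0" using up by (simp add: xz frame_simps)
  have "(x + (z * s / q) *\<^sub>R w) \<bullet> v = 0" for v
    using normal_orthogonal[OF N w, of v] unfolding tangent_vector_def grad cap_slope_def xz
    by (simp add: frame_simps q_def mult_ac)
  then have "x + (z * s / q) *\<^sub>R w = 0"
    by (metis inner_eq_zero_iff)
  then have x: "x = (- (z * s / q)) *\<^sub>R w" by (simp add: eq_neg_iff_add_eq_0)
  have "norm (N (surf w)) = 1"
    using N w unfolding unit_normal_def surface_def by auto
  then have "(norm x)\<^sup>2 + z\<^sup>2 = 1"
    using norm_frame[of x z] xz by simp
  then have "(z * s / q)\<^sup>2 * (norm w)\<^sup>2 + z\<^sup>2 = 1"
    by (simp add: x power_mult_distrib power_divide)
  moreover have "q\<^sup>2 * ((z * s / q)\<^sup>2 * (norm w)\<^sup>2 + z\<^sup>2) = z\<^sup>2 * (s\<^sup>2 * (norm w)\<^sup>2 + q\<^sup>2)"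
    using q(1) by (simp add: power_divide power_mult_distrib distrib_left)
  ultimately have "z = q" using q z by (simp add: power2_eq_iff)
  then show ?thesis using q(1) xz x by (simp add: J_lin q_def[symmetric])
qed

text \<open>
  Follow the difference \<open>\<psi>\<close> of the two heights along the line through the maximum in the principal
  direction.  Let \<open>m\<close> be the normal of the graph, \<open>n\<close> that of the cap and \<open>g\<close> the velocity of the lift
  of the line to the cap.  As each normal is orthogonal to its own surface,
  \<open>\<psi>' * (m \<bullet> E) = (n - m) \<bullet> g\<close>.  At the maximum \<open>n = m\<close>, and there \<open>n\<close> has derivative \<open>- s *\<^sub>R e\<close>, because
  the cap is umbilic, and \<open>m\<close> has derivative \<open>- k *\<^sub>R e\<close>.  So the right-hand side has derivative
  \<open>k - s\<close>: if this were positive, \<open>\<psi>\<close> would increase away from its maximum.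
\<close>

lemma principal_curvature_le_at_max:
  assumes N: "unit_normal surface N" and up: "\<And>w. norm w < r \<Longrightarrow> N (surf w) \<bullet> E > 0"
    and sr: "\<bar>s\<bar> * r < 1" and w0: "norm w0 < r"
    and max: "\<And>w. norm w < r \<Longrightarrow> F w - cap_height r s w \<le> F w0 - cap_height r s w0"
    and e: "e \<in> tangent_space surface (surf w0)" "norm e = 1"
    and k: "- frechet_derivative N (at (surf w0)) e = k *\<^sub>R e"
  shows "k \<le> s"
proof (rule ccontr)
  assume "\<not> k \<le> s"
  then have ks: "k > s" by simp
  have grad: "frechet_derivative F (at w0) v = cap_slope s w0 v" for v
    by (rule gradients_agree_at_max[OF sr w0 max])
  obtain v where ev: "e = tangent_vector w0 v"
    using tangent_space_surfE[OF _ e(1)] w0 by auto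
  let ?w = "\<lambda>t::real. w0 + t *\<^sub>R v"
  let ?q = "\<lambda>t. sqrt (1 - s\<^sup>2 * (norm (?w t))\<^sup>2)"
  obtain d where d: "d > 0" "\<And>t. \<bar>t\<bar> < d \<Longrightarrow> norm (?w t) < r"
    using line_stays_in_disk[OF w0] by blast
  have q: "?q t > 0" if "\<bar>t\<bar> < d" for t
    using cap_radicand_pos[OF sr, of "?w t"] d(2)[OF that] by simp
  define m where "m t = N (surf (?w t))" for t
  define n where "n t = - s *\<^sub>R J (?w t) + ?q t *\<^sub>R E" for t
  define g where "g t = J v + cap_slope s (?w t) v *\<^sub>R E" for t
  define \<psi> where "\<psi> t = F (?w t) - cap_height r s (?w t)" for t
  define \<psi>' where "\<psi>' t = frechet_derivative F (at (?w t)) v - cap_slope s (?w t) v" for t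
  have psi: "(\<psi> has_real_derivative \<psi>' t) (at t)" if "\<bar>t\<bar> < d" for t
    unfolding \<psi>_def \<psi>'_def cap_slope_def using d(2)[OF that]
    by (intro DERIV_diff surf_line_deriv(1) cap_height_line_deriv sr) auto
  \<comment> \<open>The sign of the slope of the difference is read off from the two normals.\<close>
  have psi_m: "\<psi>' t * (m t \<bullet> E) = (n t - m t) \<bullet> g t" if "\<bar>t\<bar> < d" for t
  proof -
    have "m t \<bullet> tangent_vector (?w t) v = 0"
      unfolding m_def by (rule normal_orthogonal[OF N d(2)[OF that]])
    then have 1: "m t \<bullet> J v = - frechet_derivative F (at (?w t)) v * (m t \<bullet> E)"
      by (simp add: tangent_vector_def inner_add_right)
    have "n t \<bullet> g t = - s * (?w t \<bullet> v) + ?q t * cap_slope s (?w t) v"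
      unfolding n_def g_def by (simp add: frame_simps)
    also have "\<dots> = 0" using q[OF that] by (simp add: cap_slope_def)
    finally show ?thesis
      using 1 by (simp add: inner_diff_left g_def inner_add_right \<psi>'_def algebra_simps)
  qed
  have nm0: "n 0 - m 0 = 0"
    unfolding n_def m_def using normal_eq_cap_normal[OF N up[OF w0] sr w0 grad] by simp
  have n': "(n has_vector_derivative - s *\<^sub>R e) (at 0)"
  proof -
    have Jd: "((\<lambda>t. - s *\<^sub>R (J w0 + t *\<^sub>R J v)) has_vector_derivative
            - s *\<^sub>R (0 + (0 *\<^sub>R 0 + 1 *\<^sub>R J v))) (at 0)"
      by (intro has_vector_derivative_scaleR derivative_intros
          bounded_linear.has_vector_derivative[OF bounded_linear_scaleR_right])
    have "s\<^sup>2 * (norm (?w 0))\<^sup>2 < 1"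
      using cap_radicand_pos[OF sr, of w0] w0 by simp
    from has_vector_derivative_add[OF Jd has_vector_derivative_scaleR[OF
          cap_normal_height_deriv[OF this] has_vector_derivative_const]]
    have "((\<lambda>t. - s *\<^sub>R (J w0 + t *\<^sub>R J v) + ?q t *\<^sub>R E) has_vector_derivative
            - s *\<^sub>R J v + (- s\<^sup>2 * (w0 \<bullet> v) / ?q 0) *\<^sub>R E) (at 0)"
      by simp
    also have "- s *\<^sub>R J v + (- s\<^sup>2 * (w0 \<bullet> v) / ?q 0) *\<^sub>R E = - s *\<^sub>R e"
      by (simp add: ev tangent_vector_def grad cap_slope_def scaleR_add_right power2_eq_square)
    finally show ?thesis by (simp add: n_def[abs_def] J_lin)
  qed
  have m': "(m has_vector_derivative - k *\<^sub>R e) (at 0)"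
  proof -
    let ?DN = "frechet_derivative N (at (surf w0))"
    have DN: "(N has_derivative ?DN) (at (surf w0))"
      using N w0 frechet_derivative_works
      unfolding surface_def unit_normal_def by force
    have "((\<lambda>t. surf (?w t)) has_vector_derivative e) (at 0)"
      using surf_line_deriv(2)[of w0 0 v UNIV] w0 ev by simp
    from has_derivative_compose[OF this[unfolded has_vector_derivative_def], of N ?DN] DN
    have "(m has_derivative (\<lambda>h. ?DN (h *\<^sub>R e))) (at 0)"
      unfolding m_def by simp
    moreover have "?DN (h *\<^sub>R e) = h *\<^sub>R (- k *\<^sub>R e)" for h
      using linear_cmul[OF has_derivative_linear[OF DN], of h e] k
      by (metis minus_equation_iff scaleR_minus_left)
    ultimately show ?thesis by (simp add: has_vector_derivative_def)
  qed
  have g0: "g 0 = e" by (simp add: g_def ev tangent_vector_def grad)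
  have "isCont (\<lambda>t. ?q t) 0" by (intro continuous_intros)
  then have contg: "isCont g 0"
    unfolding g_def cap_slope_def using q[of 0] d(1) by (intro continuous_intros) auto
  have "((\<lambda>t. n t - m t) has_vector_derivative (k - s) *\<^sub>R e) (at 0)"
    using has_vector_derivative_diff[OF n' m'] by (simp add: algebra_simps)
  \<comment> \<open>As \<open>n - m\<close> vanishes at \<open>0\<close>, the product rule leaves the single term \<open>(n - m)' \<bullet> g\<close>.\<close>
  then have "((\<lambda>t. (1 / t) *\<^sub>R (n t - m t)) \<longlongrightarrow> (k - s) *\<^sub>R e) (at 0)"
    by (rule vector_derivative_quotient) (rule nm0)
  then have "((\<lambda>t. ((1 / t) *\<^sub>R (n t - m t)) \<bullet> g t) \<longlongrightarrow> ((k - s) *\<^sub>R e) \<bullet> g 0) (at 0)"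
    using contg unfolding isCont_def by (rule tendsto_inner)
  moreover have "((k - s) *\<^sub>R e) \<bullet> g 0 = k - s"
    using e(2) by (simp add: g0 dot_square_norm)
  ultimately have "eventually (\<lambda>t. ((1 / t) *\<^sub>R (n t - m t)) \<bullet> g t > 0) (at 0)"
    using ks by (intro order_tendstoD(1)[of _ "k - s"]) auto
  then obtain d' where d': "d' > 0" "\<And>t. t \<noteq> 0 \<Longrightarrow> \<bar>t\<bar> < d' \<Longrightarrow> ((1 / t) *\<^sub>R (n t - m t)) \<bullet> g t > 0"
    unfolding eventually_at dist_real_def by auto
  define b where "b = min d d' / 2"
  have b: "0 < b" "b < d" "b < d'" using d(1) d'(1) by (auto simp: b_def)
  have "\<psi> 0 < \<psi> b"
  proof (rule DERIV_pos_imp_increasing_open[OF b(1)])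
    fix t assume t: "0 < t" "t < b"
    then have "(n t - m t) \<bullet> g t > 0" using d'(2)[of t] b by (simp add: zero_less_divide_iff)
    then have "\<psi>' t * (m t \<bullet> E) > 0" using psi_m[of t] t b by simp
    moreover have "m t \<bullet> E > 0" unfolding m_def using t b by (intro up d(2)) auto
    ultimately have "\<psi>' t > 0" by (simp add: zero_less_mult_iff)
    then show "\<exists>y. (\<psi> has_real_derivative y) (at t) \<and> 0 < y"
      using psi[of t] t b by auto
  next
    have "isCont \<psi> t" if "0 \<le> t" "t \<le> b" for t
      using that b by (intro DERIV_isCont[OF psi]) auto
    then show "continuous_on {0..b} \<psi>" by (intro continuous_at_imp_continuous_on) auto
  qed
  moreover have "\<psi> b \<le> \<psi> 0"
    using max[OF d(2)[of b]] b by (simp add: \<psi>_def)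
  ultimately show False by simp
qed

text \<open>
  At an interior maximum of the difference both principal curvatures would be at most \<open>s\<close>, against
  \<open>s < H\<close>.  So the maximum lies on the boundary circle, where both heights vanish.
\<close>

lemma below_cap_of_smaller_curvature:
  assumes N: "unit_normal surface N" and up: "\<And>w. norm w < r \<Longrightarrow> N (surf w) \<bullet> E > 0"
    and H: "\<And>p. p \<in> surface \<Longrightarrow> has_mean_curvature surface N p H"
    and sr: "\<bar>s\<bar> * r < 1" and sH: "s < H" and w: "norm w \<le> r"
  shows "F w \<le> cap_height r s w"
proof (rule ccontr)
  assume above: "\<not> F w \<le> cap_height r s w"
  have cont: "continuous_on (cball 0 r) (\<lambda>w. F w - cap_height r s w)"
    by (intro continuous_intros continuous_F continuous_on_cap_height sr)
  obtain w0 where w0: "norm w0 \<le> r"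
    and max: "\<And>w. norm w \<le> r \<Longrightarrow> F w - cap_height r s w \<le> F w0 - cap_height r s w0"
    using continuous_attains_sup[OF compact_cball _ cont] r_pos by auto
  have "F w0 - cap_height r s w0 > 0" using max[OF w] above by linarith
  then have in0: "norm w0 < r"
    using w0 F_boundary[of w0] cap_height_boundary[of w0 r s] by (cases "norm w0 = r") auto
  obtain k1 k2 where "principal_curvatures surface N (surf w0) k1 k2" "H = (k1 + k2) / 2"
    using H[of "surf w0"] w0 unfolding has_mean_curvature_def surface_def by auto
  moreover have "k \<le> s" if "e \<in> tangent_space surface (surf w0)" "norm e = 1"
      "- frechet_derivative N (at (surf w0)) e = k *\<^sub>R e" for e k
    by (rule principal_curvature_le_at_max[OF N up sr in0 _ that]) (use max in auto)
  ultimately have "k1 \<le> s" "k2 \<le> s"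
    unfolding principal_curvatures_def by blast+
  then show False using \<open>H = (k1 + k2) / 2\<close> sH by simp
qed

text \<open>
  The limit of the strict comparison from the left.  The upper end \<open>s * r = 1\<close>, the lower hemisphere,
  is included for the sake of the bound on the mean curvature.
\<close>

lemma below_cap_same_curvature:
  assumes N: "unit_normal surface N" and up: "\<And>w. norm w < r \<Longrightarrow> N (surf w) \<bullet> E > 0"
    and H: "\<And>p. p \<in> surface \<Longrightarrow> has_mean_curvature surface N p H"
    and s: "- 1 < s * r" "s * r \<le> 1" "s \<le> H" and w: "norm w < r"
  shows "F w \<le> cap_height r s w"
proof (rule tendsto_lowerbound)
  show "((\<lambda>s. cap_height r s w) \<longlongrightarrow> cap_height r s w) (at_left s)"
    using s r_pos w by (intro tendsto_cap_height) (auto simp: abs_mult_pos[symmetric] abs_le_iff)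
  have "\<forall>\<^sub>F s' in at_left s. s' \<in> {-1 / r<..<s}"
    using s(1) r_pos by (intro eventually_at_left_real) (simp add: field_simps)
  then show "\<forall>\<^sub>F s' in at_left s. F w \<le> cap_height r s' w"
  proof eventually_elim
    case (elim s')
    then have "s' * r < s * r" "- 1 < s' * r" using r_pos by (auto simp: field_simps)
    moreover have "\<bar>s'\<bar> * r = \<bar>s' * r\<bar>" using r_pos by (simp add: abs_mult)
    ultimately have "\<bar>s'\<bar> * r < 1" using s(2) by linarith
    then show ?case
      using below_cap_of_smaller_curvature[OF N up H, of s' w] elim s(3) w by auto
  qed
qed simp

text \<open>
  If \<open>H\<close> were at least \<open>1 / r\<close>, then \<open>F\<close> would lie below the hemisphere of radius \<open>r\<close>.  At distance \<open>t\<close> from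
  the circle, the hemisphere has depth larger than \<open>sqrt (r * t)\<close>, while differentiability at a boundary
  point bounds the depth of the graph by \<open>K * t\<close>.  For small \<open>t\<close> this is impossible.
\<close>

lemma mean_curvature_bound:
  assumes N: "unit_normal surface N" and up: "\<And>w. norm w < r \<Longrightarrow> N (surf w) \<bullet> E > 0"
    and H: "\<And>p. p \<in> surface \<Longrightarrow> has_mean_curvature surface N p H"
  shows "H * r < 1"
proof (rule ccontr)
  assume "\<not> H * r < 1"
  then have Hr: "1 / r \<le> H" using r_pos by (simp add: field_simps)
  define u :: "real^2" where "u = axis 1 1"
  have u: "norm u = 1" by (simp add: u_def)
  define \<phi> where "\<phi> t = F (r *\<^sub>R u + t *\<^sub>R (- u))" for t
  define a where "a = frechet_derivative F (at (r *\<^sub>R u)) (- u)"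
  have "(\<phi> has_real_derivative a) (at 0)"
    unfolding \<phi>_def a_def using surf_line_deriv(1)[of "r *\<^sub>R u" 0 "- u"] r_pos u by simp
  then have "((\<lambda>t. (\<phi> (0 + t) - \<phi> 0) / t) \<longlongrightarrow> a) (at 0)"
    by (simp add: DERIV_def)
  moreover have "\<phi> 0 = 0" using F_boundary[of "r *\<^sub>R u"] u r_pos by (simp add: \<phi>_def)
  ultimately have "((\<lambda>t. \<phi> t / t) \<longlongrightarrow> a) (at 0)" by simp
  then have "\<forall>\<^sub>F t in at 0. a - 1 < \<phi> t / t"
    by (rule order_tendstoD(1)) simp
  then obtain d where d: "d > 0" "\<And>t. t \<noteq> 0 \<Longrightarrow> \<bar>t\<bar> < d \<Longrightarrow> a - 1 < \<phi> t / t"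
    unfolding eventually_at dist_real_def by auto
  define K where "K = \<bar>a\<bar> + 1"
  have K: "K > 0" by (simp add: K_def)
  \<comment> \<open>The bound \<open>r / K\<^sup>2\<close> is where \<open>K * t\<close> and \<open>sqrt (r * t)\<close> cross.\<close>
  have "0 < min (min d r) (r / K\<^sup>2)" using d(1) r_pos K by simp
  then obtain t where t: "0 < t" "t < d" "t < r" "t < r / K\<^sup>2"
    using dense by (metis min_less_iff_conj)
  have lower: "- (K * t) < \<phi> t"
  proof -
    have "- K \<le> a - 1" by (simp add: K_def)
    then have "- K < \<phi> t / t" using d(2)[of t] t by simp
    then show ?thesis using t(1) by (simp add: field_simps)
  qed
  define w where "w = (r - t) *\<^sub>R u"
  have nw: "norm w = r - t" using t u by (simp add: w_def)
  have pos: "r\<^sup>2 - (r - t)\<^sup>2 > 0" and big: "r\<^sup>2 - (r - t)\<^sup>2 > r * t"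
    using t r_pos by (auto simp: power2_eq_square algebra_simps intro: add_pos_pos mult_strict_right_mono)
  have "cap_height r (1 / r) w = - sqrt (r\<^sup>2 - (r - t)\<^sup>2)"
  proof -
    have "1 - (1 / r)\<^sup>2 * (r - t)\<^sup>2 = (r\<^sup>2 - (r - t)\<^sup>2) / r\<^sup>2"
      using r_pos by (simp add: field_simps)
    then have "sqrt (1 - (1 / r)\<^sup>2 * (norm w)\<^sup>2) = sqrt (r\<^sup>2 - (r - t)\<^sup>2) / r"
      using r_pos by (simp add: nw real_sqrt_divide)
    moreover have "sqrt (1 - (1 / r)\<^sup>2 * r\<^sup>2) = 0"
      using r_pos by (simp add: field_simps)
    ultimately have "cap_height r (1 / r) w = - ((r\<^sup>2 - (r - t)\<^sup>2) / sqrt (r\<^sup>2 - (r - t)\<^sup>2))"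
      using r_pos by (simp add: cap_height_def nw) (metis minus_diff_eq minus_divide_left)
    then show ?thesis using pos by (simp add: real_div_sqrt)
  qed
  moreover have "F w \<le> cap_height r (1 / r) w"
    using below_cap_same_curvature[OF N up H, of "1 / r" w] Hr r_pos nw t by auto
  moreover have "\<phi> t = F w" by (simp add: \<phi>_def w_def algebra_simps)
  ultimately have "sqrt (r\<^sup>2 - (r - t)\<^sup>2) < K * t" using lower by linarith
  then have "(sqrt (r\<^sup>2 - (r - t)\<^sup>2))\<^sup>2 < (K * t)\<^sup>2"
    using pos by (intro power_strict_mono) auto
  then have "r\<^sup>2 - (r - t)\<^sup>2 < (K * t)\<^sup>2" using pos by simp
  then have "r * t < K\<^sup>2 * t * t" using big by (simp add: power2_eq_square mult_ac)
  then have "r < K\<^sup>2 * t" using t(1) by simp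
  then show False using t(4) K by (simp add: field_simps)
qed

lemma flip: "disk_graph J (- E) r (\<lambda>w. - F w)"
proof (rule disk_graph.intro)
  show "\<exists>z y. x = J z + y *\<^sub>R - E" for x
    using frame[of x] by (metis minus_minus scaleR_minus_left scaleR_minus_right)
qed (auto simp: linear_J J_inner E_J E_E r_pos F_boundary intro: F_diff differentiable_minus)

lemma flip_surf: "disk_graph.surf c J (- E) (\<lambda>w. - F w) = surf"
  and flip_surface: "disk_graph.surface c J (- E) r (\<lambda>w. - F w) = surface"
  by (simp_all add: fun_eq_iff disk_graph.surf_def[OF flip] surf_def
        disk_graph.surface_def[OF flip] surface_def)

text \<open>
  The lower bounds for \<open>F\<close> and for \<open>H\<close> are the upper bounds for the reflected graph \<open>- F\<close>: with
  respect to \<open>- E\<close>, the normal \<open>- N\<close> points upwards and the mean curvature is \<open>- H\<close>.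
\<close>

lemma eq_cap_if_normal_up:
  assumes N: "unit_normal surface N" and up: "\<And>w. norm w < r \<Longrightarrow> N (surf w) \<bullet> E > 0"
    and H: "\<And>p. p \<in> surface \<Longrightarrow> has_mean_curvature surface N p H"
  shows "\<bar>H\<bar> * r < 1" "norm w \<le> r \<Longrightarrow> F w = cap_height r H w"
proof -
  interpret flip: disk_graph c J "- E" r "\<lambda>w. - F w" by (rule flip)
  have N': "unit_normal flip.surface (\<lambda>p. - N p)"
    using unit_normal_minus[OF N] by (simp add: flip_surface)
  have up': "- N (flip.surf w) \<bullet> - E > 0" if "norm w < r" for w
    using up[OF that] by (simp add: flip_surf)
  have H': "has_mean_curvature flip.surface (\<lambda>p. - N p) p (- H)" if "p \<in> flip.surface" for p
    using has_mean_curvature_minus[OF _ H] N that unfolding flip_surface unit_normal_def by blast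
  have b: "H * r < 1" "- H * r < 1"
    by (rule mean_curvature_bound[OF N up H] flip.mean_curvature_bound[OF N' up' H']; assumption)+
  then show "\<bar>H\<bar> * r < 1" by (simp add: abs_if)
  show "F w = cap_height r H w" if w: "norm w \<le> r"
  proof (cases "norm w = r")
    case True
    then show ?thesis by (simp add: F_boundary cap_height_boundary)
  next
    case False
    then have "F w \<le> cap_height r H w"
      using w b by (intro below_cap_same_curvature[OF N up H]) auto
    moreover have "- F w \<le> cap_height r (- H) w"
      using False w b by (intro flip.below_cap_same_curvature[OF N' up' H']) auto
    ultimately show ?thesis by (simp add: cap_height_minus)
  qed
qed

lemma eq_cap:
  assumes "constant_mean_curvature surface"
  obtains s where "\<bar>s\<bar> * r < 1" "\<And>w. norm w \<le> r \<Longrightarrow> F w = cap_height r s w"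
proof -
  obtain N H where "unit_normal_field surface N"
      and H: "\<And>p. p \<in> surface \<Longrightarrow> has_mean_curvature surface N p H"
    using assms unfolding constant_mean_curvature_def by blast
  then have N: "unit_normal surface N" by (intro unit_normal_field_imp_unit_normal)
  from normal_constant_sign[OF N] show thesis
  proof
    assume "\<forall>w\<in>ball 0 r. N (surf w) \<bullet> E > 0"
    then show thesis using eq_cap_if_normal_up[OF N _ H] that by simp
  next
    assume "\<forall>w\<in>ball 0 r. N (surf w) \<bullet> E < 0"
    then have up: "- N (surf w) \<bullet> E > 0" if "norm w < r" for w
      using that by simp
    have H': "has_mean_curvature surface (\<lambda>p. - N p) p (- H)" if "p \<in> surface" for p
      using has_mean_curvature_minus[OF _ H[OF that]] N that unfolding unit_normal_def by blast
    show thesis using that[of "- H"] eq_cap_if_normal_up[OF unit_normal_minus[OF N] up H'] by simp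
  qed
qed

section \<open>The graph as a small spherical cap\<close>

text \<open>
  The part \<open>U\<close> of the sphere strictly below the plane of the circle is the image of the open disk, so
  it is connected.  It is a whole component of the sphere minus the circle, because the signed height
  over the plane does not vanish off the circle and so has constant sign on any connected set.
\<close>

lemma cap_is_small_spherical_cap:
  assumes s: "s > 0" "s * r < 1" and F: "\<And>w. norm w \<le> r \<Longrightarrow> F w = cap_height r s w"
  shows "small_spherical_cap {c + J w | w. norm w = r} r surface"
proof -
  define R where "R = 1 / s"
  define h where "h = sqrt (R\<^sup>2 - r\<^sup>2)"
  define a where "a = c + h *\<^sub>R E"
  define C where "C = {c + J w | w. norm w = r}"
  have R: "r < R" "R > 0" using s by (auto simp: R_def field_simps)
  have "r\<^sup>2 < R\<^sup>2" using R r_pos by (intro power_strict_mono) auto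
  then have h: "h > 0" "h\<^sup>2 = R\<^sup>2 - r\<^sup>2" by (auto simp: h_def)
  have sq: "sqrt (1 - s\<^sup>2 * x) / s = sqrt (R\<^sup>2 - x)" for x
  proof -
    have "R\<^sup>2 - x = (1 - s\<^sup>2 * x) / s\<^sup>2" using s by (simp add: R_def field_simps)
    then show ?thesis using s by (simp add: real_sqrt_divide)
  qed
  have Fh: "F w = h - sqrt (R\<^sup>2 - (norm w)\<^sup>2)" if "norm w \<le> r" for w
    using F[OF that] cap_height_eq[of s r w] that s sq
    by (simp add: diff_divide_distrib h_def)
  have sphere: "c + J w + z *\<^sub>R E \<in> sphere a R \<longleftrightarrow> (norm w)\<^sup>2 + (z - h)\<^sup>2 = R\<^sup>2" for w z
  proof -
    have "dist a (c + J w + z *\<^sub>R E) = norm (J w + (z - h) *\<^sub>R E)"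
      unfolding dist_commute[of a] by (simp add: a_def dist_norm algebra_simps)
    then show ?thesis
      using norm_frame[of w "z - h"] R(2) power2_eq_iff_nonneg[of "norm (J w + (z - h) *\<^sub>R E)" R]
      by simp
  qed
  have coords: "\<exists>w z. x = c + J w + z *\<^sub>R E" for x
    using frame[of "x - c"] by (simp add: algebra_simps)
  have height: "(c + J w + z *\<^sub>R E - c) \<bullet> E = z" for w z
    by (simp add: frame_simps add.assoc)
  define U where "U = {x \<in> sphere a R. (x - c) \<bullet> E < 0}"
  have U: "U = surf ` ball 0 r"
  proof (intro equalityI subsetI)
    fix x assume x: "x \<in> U"
    obtain w z where xw: "x = c + J w + z *\<^sub>R E" using coords by blast
    have z: "z < 0" and eq: "(norm w)\<^sup>2 + (z - h)\<^sup>2 = R\<^sup>2"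
      using x xw sphere height by (auto simp: U_def)
    have "h\<^sup>2 < (h - z)\<^sup>2" using z h(1) by (intro power_strict_mono) auto
    then have "(norm w)\<^sup>2 < r\<^sup>2" using eq h(2) by (simp add: power2_commute)
    then have w: "norm w < r" using r_pos by (simp add: power_less_imp_less_base)
    have "R\<^sup>2 - (norm w)\<^sup>2 = (h - z)\<^sup>2" using eq by (simp add: power2_commute)
    then have "sqrt (R\<^sup>2 - (norm w)\<^sup>2) = h - z" using z h(1) by simp
    then have "F w = z" using Fh[of w] w by simp
    then show "x \<in> surf ` ball 0 r" using xw w by (auto simp: surf_def)
  next
    fix x assume "x \<in> surf ` ball 0 r"
    then obtain w where xw: "x = surf w" and w: "norm w < r" by auto
    have w2: "(norm w)\<^sup>2 < r\<^sup>2" using w by (intro power_strict_mono) auto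
    then have "h < sqrt (R\<^sup>2 - (norm w)\<^sup>2)" by (simp add: h_def)
    moreover have "(F w - h)\<^sup>2 = R\<^sup>2 - (norm w)\<^sup>2"
      using Fh[of w] w w2 \<open>r\<^sup>2 < R\<^sup>2\<close> by simp
    ultimately show "x \<in> U"
      using Fh[of w] w sphere[of w "F w"] height[of w "F w"]
      by (simp add: U_def xw surf_def)
  qed
  have Csphere: "C \<subseteq> sphere a R"
    using sphere[of _ 0] h(2) by (auto simp: C_def)
  have off: "(x - c) \<bullet> E \<noteq> 0" if "x \<in> sphere a R - C" for x
  proof
    assume 0: "(x - c) \<bullet> E = 0"
    obtain w z where xw: "x = c + J w + z *\<^sub>R E" using coords by blast
    then have "z = 0" using 0 height by simp
    then have "(norm w)\<^sup>2 = r\<^sup>2" using that xw sphere[of w z] h(2) by simp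
    then have "norm w = r" using r_pos by simp
    then show False using that xw \<open>z = 0\<close> by (auto simp: C_def)
  qed
  have "U \<in> components (sphere a R - C)"
    unfolding in_components_maximal
  proof (intro conjI allI impI)
    show "U \<noteq> {}" using U r_pos by auto
    show "U \<subseteq> sphere a R - C" using height[of _ 0] by (auto simp: U_def C_def)
    show "connected U" unfolding U
      by (intro connected_continuous_image continuous_on_subset[OF continuous_surf]) auto
    fix D assume D: "D \<noteq> {} \<and> U \<subseteq> D \<and> D \<subseteq> sphere a R - C \<and> connected D"
    have "connected ((\<lambda>x. (x - c) \<bullet> E) ` D)"
      using D by (intro connected_continuous_image continuous_intros) auto
    then have "is_interval ((\<lambda>x. (x - c) \<bullet> E) ` D)" by (simp add: is_interval_connected_1)
    moreover have "0 \<notin> (\<lambda>x. (x - c) \<bullet> E) ` D" using off D by force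
    moreover obtain y where "y \<in> U" using \<open>U \<noteq> {}\<close> by blast
    then have "(y - c) \<bullet> E \<in> (\<lambda>x. (x - c) \<bullet> E) ` D" "(y - c) \<bullet> E \<le> 0"
      using D by (auto simp: U_def)
    ultimately have "(x - c) \<bullet> E < 0" if "x \<in> D" for x
      using that unfolding is_interval_1 by (meson imageI not_le)
    then show "D = U" using D by (auto simp: U_def)
  qed
  moreover have "surface = U \<union> C"
  proof -
    have "surf ` sphere 0 r = C"
      unfolding C_def using F_boundary by (auto simp: surf_def image_iff)
    moreover have "cball (0::real^2) r = ball 0 r \<union> sphere 0 r" by auto
    ultimately show ?thesis unfolding surface_def U by (simp add: image_Un)
  qed
  ultimately have "spherical_cap C a R surface"
    unfolding spherical_cap_def using Csphere by blast
  moreover have "surface \<subseteq> hemisphere a R (- E)"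
  proof -
    have "0 \<le> - E \<bullet> (x - a)" if "x \<in> U \<union> C" for x
    proof -
      have "(x - c) \<bullet> E \<le> 0"
        using that height[of _ 0] by (auto simp: U_def C_def)
      moreover have "- E \<bullet> (x - a) = h - (x - c) \<bullet> E"
        by (simp add: a_def algebra_simps frame_simps inner_commute)
      ultimately show ?thesis using h(1) by simp
    qed
    then show ?thesis
      using \<open>surface = U \<union> C\<close> Csphere unfolding hemisphere_def U_def by blast
  qed
  moreover have "- E \<noteq> 0" using E_E by auto
  ultimately show ?thesis
    unfolding small_spherical_cap_def C_def[symmetric] using R(1) by blast
qed

lemma disk_or_small_spherical_cap:
  assumes "constant_mean_curvature surface"
  shows "surface = {c + J w | w. norm w \<le> r} \<or>
    small_spherical_cap {c + J w | w. norm w = r} r surface"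
proof -
  obtain s where s: "\<bar>s\<bar> * r < 1" and F: "\<And>w. norm w \<le> r \<Longrightarrow> F w = cap_height r s w"
    using eq_cap[OF assms] by blast
  consider "s = 0" | "s > 0" | "s < 0" by linarith
  then show ?thesis
  proof cases
    case 1
    then have "surf w = c + J w" if "norm w \<le> r" for w
      using F[OF that] by (simp add: surf_def cap_height_def)
    then have "surface = {c + J w | w. norm w \<le> r}"
      unfolding surface_def by (force simp: image_iff)
    then show ?thesis by blast
  next
    case 2
    then show ?thesis using cap_is_small_spherical_cap[of s] s F by simp
  next
    case 3
    interpret flip: disk_graph c J "- E" r "\<lambda>w. - F w" by (rule flip)
    show ?thesis
      using flip.cap_is_small_spherical_cap[of "- s"] 3 s F
      by (simp add: cap_height_minus flip_surface)
  qed
qed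

end

section \<open>Coordinates adapted to the plane\<close>

lemma space_point_inner: "space_point u z \<bullet> space_point v y = u \<bullet> v + z * y"
  by (simp add: space_point_def inner_vec_def sum_2 sum_3)

lemma space_point_add: "space_point u z + space_point v y = space_point (u + v) (z + y)"
  by (simp add: space_point_def vec_eq_iff forall_3)

lemma space_point_scale: "k *\<^sub>R space_point u z = space_point (k *\<^sub>R u) (k * z)"
  by (simp add: space_point_def vec_eq_iff forall_3)

lemma space_point_height: "space_point u z $ 3 = z"
  by (simp add: space_point_def)

lemma space_point_surj: "\<exists>u z. x = space_point u z"
  by (rule exI[of _ "vector [x$1, x$2]"], rule exI[of _ "x$3"])
     (simp add: space_point_def vec_eq_iff forall_3)

text \<open>
  \<open>T\<close> is inverted on the plane: \<open>J\<close> and \<open>E\<close> are the preimages of the coordinate directions, and the origin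
  of the coordinates is moved to the centre of the disk.
\<close>

lemma graph_over_disk_frame:
  assumes "c \<in> P" "r > 0" "graph_over_disk P c r S"
  obtains J E F where "disk_graph J E r F" "S = disk_graph.surface c J E r F"
    "P \<inter> cball c r = {c + J w | w. norm w \<le> r}" "P \<inter> sphere c r = {c + J w | w. norm w = r}"
proof -
  obtain T D f where T: "rigid_motion T" and TP: "T ` P = {x. x$3 = 0}"
    and D: "D = {u. space_point u 0 \<in> T ` (P \<inter> cball c r)}"
    and f: "smooth_near D f" and TS: "T ` S = {space_point u (f u) | u. u \<in> D}"
    and f0: "\<forall>u. space_point u 0 \<in> T ` (P \<inter> sphere c r) \<longrightarrow> f u = 0"
    using assms(3) unfolding graph_over_disk_def by (elim exE conjE) (rule that; assumption)
  obtain Q b where Q: "orthogonal_transformation Q" and Tdef: "T = (\<lambda>x. Q x + b)"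
    using T unfolding rigid_motion_def by blast
  define A where "A = inv Q"
  have A: "orthogonal_transformation A"
    unfolding A_def by (rule orthogonal_transformation_inv[OF Q])
  have QA: "Q (A y) = y" and AQ: "A (Q y) = y" for y
    using orthogonal_transformation_bij[OF Q]
    by (simp_all add: A_def surj_f_inv_f bij_is_surj inv_f_f bij_is_inj)
  have linA: "linear A" and linQ: "linear Q"
    using A Q by (auto simp: orthogonal_transformation_linear)
  have innerA: "A x \<bullet> A y = x \<bullet> y" for x y
    using A unfolding orthogonal_transformation_def by blast
  have injT: "inj T"
    unfolding Tdef by (rule injI) (metis AQ add_right_cancel)
  have TA: "T (c + A y) = T c + y" for y
    by (simp add: Tdef linear_add[OF linQ] QA)
  have "T c $ 3 = 0" using TP assms(1) by blast
  then obtain u0 where u0: "T c = space_point u0 0"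
    using space_point_surj[of "T c"] space_point_height by metis
  define J where "J w = A (space_point w 0)" for w
  define E where "E = A (space_point 0 1)"
  define F where "F w = f (u0 + w)" for w
  have JE: "J w + z *\<^sub>R E = A (space_point w z)" for w z
    unfolding J_def E_def
    by (simp add: linear_cmul[OF linA, symmetric] linear_add[OF linA, symmetric]
        space_point_scale space_point_add)
  have T_frame: "T (c + J w + z *\<^sub>R E) = space_point (u0 + w) z" for w z
    unfolding add.assoc JE TA u0 by (simp add: space_point_add)
  have T_plane: "T (c + J w) = space_point (u0 + w) 0" for w
    using T_frame[of w 0] by simp
  have frame: "\<exists>w z. x = J w + z *\<^sub>R E" for x
    unfolding JE using space_point_surj[of "Q x"] AQ by metis
  have in_P: "c + J w + z *\<^sub>R E \<in> P \<longleftrightarrow> z = 0" for w z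
  proof -
    have "c + J w + z *\<^sub>R E \<in> P \<longleftrightarrow> T (c + J w + z *\<^sub>R E) \<in> T ` P"
      by (simp add: inj_image_mem_iff[OF injT])
    then show ?thesis by (simp add: TP T_frame space_point_height)
  qed
  have normJ: "norm (J w) = norm w" for w
    by (simp add: norm_eq_sqrt_inner J_def innerA space_point_inner)
  have plane: "P = {c + J w | w. True}"
  proof (intro equalityI subsetI)
    fix x assume "x \<in> P"
    moreover obtain w z where "x = c + J w + z *\<^sub>R E"
      using frame[of "x - c"] by (auto simp: algebra_simps)
    ultimately show "x \<in> {c + J w | w. True}" using in_P by auto
  qed (use in_P[of _ 0] in auto)
  have disk: "P \<inter> cball c r = {c + J w | w. norm w \<le> r}"
    and circle: "P \<inter> sphere c r = {c + J w | w. norm w = r}"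
    unfolding plane by (auto simp: dist_norm normJ)
  have in_disk: "u0 + w \<in> D \<longleftrightarrow> norm w \<le> r" for w
  proof -
    have "u0 + w \<in> D \<longleftrightarrow> c + J w \<in> P \<inter> cball c r"
      unfolding D mem_Collect_eq T_plane[symmetric] by (rule inj_image_mem_iff[OF injT])
    also have "\<dots> \<longleftrightarrow> norm w \<le> r"
      using in_P[of w 0] by (simp add: dist_norm normJ)
    finally show ?thesis .
  qed
  have dg: "disk_graph J E r F"
  proof (rule disk_graph.intro)
    show "linear J"
      by (rule linearI)
         (simp_all add: J_def linear_add[OF linA, symmetric] linear_cmul[OF linA, symmetric]
           space_point_add space_point_scale)
    show "F differentiable (at w)" if "norm w \<le> r" for w
      unfolding F_def
      by (rule differentiable_compose[of f "\<lambda>w. u0 + w"])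
         (auto intro: smooth_near_differentiable[OF f] simp: in_disk that)
    show "F w = 0" if "norm w = r" for w
      unfolding F_def
      by (rule f0[rule_format]) (use that circle T_plane[of w, symmetric] in auto)
  qed (auto simp: J_def E_def innerA space_point_inner assms(2) frame[unfolded J_def E_def])
  have D_image: "D = (\<lambda>w. u0 + w) ` cball 0 r"
  proof (intro equalityI subsetI)
    fix u assume "u \<in> D"
    then show "u \<in> (\<lambda>w. u0 + w) ` cball 0 r"
      using in_disk[of "u - u0"] by (intro image_eqI[of _ _ "u - u0"]) auto
  next
    fix u assume "u \<in> (\<lambda>w. u0 + w) ` cball 0 r"
    then obtain w where "u = u0 + w" "norm w \<le> r" by (meson imageE mem_cball_0)
    then show "u \<in> D" using in_disk by blast
  qed
  have "T ` S = (\<lambda>w. space_point (u0 + w) (f (u0 + w))) ` cball 0 r"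
    unfolding TS Setcompr_eq_image D_image image_image ..
  also have "\<dots> = T ` disk_graph.surface c J E r F"
    unfolding disk_graph.surface_def[OF dg] disk_graph.surf_def[OF dg] image_image T_frame F_def ..
  finally have "T ` S = T ` disk_graph.surface c J E r F" .
  then have "S = disk_graph.surface c J E r F"
    by (simp add: inj_image_eq_iff[OF injT])
  then show thesis using that dg disk circle by blast
qed

theorem theorem2:
  fixes P C S :: "(real^3) set" and c :: "real^3" and r :: real
  assumes "affine P" and "aff_dim P = 2"
    and "c \<in> P" and "r > 0" and "C = P \<inter> sphere c r"
    and "compact_surface_with_boundary S C"
    and "constant_mean_curvature S"
    and "graph_over_disk P c r S"
  shows "S = P \<inter> cball c r \<or> small_spherical_cap C r S"
proof -
  obtain J E F where "disk_graph J E r F" and S: "S = disk_graph.surface c J E r F"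
    and disk: "P \<inter> cball c r = {c + J w | w. norm w \<le> r}"
    and circle: "P \<inter> sphere c r = {c + J w | w. norm w = r}"
    using graph_over_disk_frame[OF assms(3,4,8)] by blast
  interpret disk_graph c J E r F by fact
  show ?thesis
    using disk_or_small_spherical_cap assms(5,7) S disk circle by simp
qed

end
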